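(* Let $U$ and $X$ be finite-dimensional inner product spaces, let $A\in\mathcal{L}(X)$ and $B\in\mathcal{L}(U,X)$ be linear maps, and let $\tau>0$. Consider the linear control system $$\dot{x}(t)+Ax(t)=Bu(t)\qquad (t\in[0,\tau]).$$ This system is weakly approximately tracking controllable on $[0,\tau]$ if and only if the control operator $B\colon U\to X$ is onto.
   Context: For $\tau>0$ and $v\in L^1([0,\tau];X)$, the relaxation norm is $$|||v|||_\tau:=\sup_{t\in[0,\tau]}\left\|\int_0^t v(s)\,\mathrm{d}s\right\|_X .$$ The system is called weakly approximately tracking controllable on $[0,\tau]$ if for every $\psi\in W^{1,2}((0,\tau);X)$ and every $\varepsilon>0$ there exists a control $u\in L^2([0,\tau];U)$ such that the solution $x$ of the system on $[0,\tau]$ with initial condition $x(0)=\psi(0)$ satisfies $|||x-\psi|||_\tau\leq\varepsilon$. *)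

theory Defs
  imports "HOL-Analysis.Analysis"
begin

text \<open>
  Functions on the interval from 0 to \<open>\<tau>\<close> are total functions on the reals whose values outside
  the interval are irrelevant. The class of values is that of separable Banach spaces, the one for
  which Bochner integrals are available; finite-dimensional normed spaces belong to it
  automatically.
\<close>

definition L2_on :: "real \<Rightarrow> (real \<Rightarrow> 'a::{banach, second_countable_topology}) \<Rightarrow> bool" where
  "L2_on \<tau> f \<longleftrightarrow>
     f \<in> borel_measurable (lebesgue_on {0..\<tau>}) \<and>
     integrable (lebesgue_on {0..\<tau>}) (\<lambda>t. (norm (f t))\<^sup>2)"

definition relaxation_norm ::
    "real \<Rightarrow> (real \<Rightarrow> 'a::{banach, second_countable_topology}) \<Rightarrow> real" where
  "relaxation_norm \<tau> v = (SUP t\<in>{0..\<tau>}. norm (integral\<^sup>L (lebesgue_on {0..t}) v))"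

definition test_function :: "real \<Rightarrow> (real \<Rightarrow> real) \<Rightarrow> bool" where
  "test_function \<tau> \<phi> \<longleftrightarrow>
     (\<forall>k t. ((deriv ^^ k) \<phi>) differentiable (at t)) \<and>
     (\<exists>K. compact K \<and> K \<subseteq> {0<..<\<tau>} \<and> (\<forall>t. t \<notin> K \<longrightarrow> \<phi> t = 0))"

definition weak_derivative ::
    "real \<Rightarrow> (real \<Rightarrow> 'a::{banach, second_countable_topology}) \<Rightarrow> (real \<Rightarrow> 'a) \<Rightarrow> bool" where
  "weak_derivative \<tau> f g \<longleftrightarrow>
     (\<forall>\<phi>. test_function \<tau> \<phi> \<longrightarrow>
        integral\<^sup>L (lebesgue_on {0<..<\<tau>}) (\<lambda>t. deriv \<phi> t *\<^sub>R f t) =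
        - integral\<^sup>L (lebesgue_on {0<..<\<tau>}) (\<lambda>t. \<phi> t *\<^sub>R g t))"

text \<open>
  Every class in the Sobolev space \<open>W\<^sup>1\<^sup>,\<^sup>2\<close> over the open interval has exactly one representative
  that is continuous up to the end points, and point values such as the one at 0 are those of this
  representative. Elements of the space are therefore represented by it.
\<close>

definition W12 :: "real \<Rightarrow> (real \<Rightarrow> 'a::{banach, second_countable_topology}) set" where
  "W12 \<tau> = {\<psi>. continuous_on {0..\<tau>} \<psi> \<and> L2_on \<tau> \<psi> \<and> (\<exists>v. L2_on \<tau> v \<and> weak_derivative \<tau> \<psi> v)}"

text \<open>
  For a square-integrable control the equation \<open>x' + A x = B u\<close> is understood in the sense of
  Caratheodory: \<open>x\<close> is absolutely continuous, that is, an indefinite integral of its derivative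
  \<open>v\<close>, and the equation holds almost everywhere.
\<close>

definition is_solution ::
    "('x::{banach, second_countable_topology} \<Rightarrow> 'x) \<Rightarrow> ('u \<Rightarrow> 'x) \<Rightarrow> real \<Rightarrow>
     (real \<Rightarrow> 'u) \<Rightarrow> 'x \<Rightarrow> (real \<Rightarrow> 'x) \<Rightarrow> bool" where
  "is_solution A B \<tau> u x0 x \<longleftrightarrow>
     (\<exists>v. integrable (lebesgue_on {0..\<tau>}) v \<and>
          (\<forall>t\<in>{0..\<tau>}. x t = x0 + integral\<^sup>L (lebesgue_on {0..t}) v) \<and>
          (AE t in lebesgue_on {0..\<tau>}. v t + A (x t) = B (u t)))"

text \<open>
  For linear \<open>A\<close> and \<open>B\<close> in finite dimensions, the solution for a given control and initial value
  exists and is unique on the interval, so quantifying existentially over it is harmless.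
\<close>

definition weakly_approx_tracking_controllable ::
    "('x::{banach, second_countable_topology} \<Rightarrow> 'x) \<Rightarrow>
     ('u::{banach, second_countable_topology} \<Rightarrow> 'x) \<Rightarrow> real \<Rightarrow> bool" where
  "weakly_approx_tracking_controllable A B \<tau> \<longleftrightarrow>
     (\<forall>\<psi>\<in>W12 \<tau>. \<forall>\<epsilon>>0. \<exists>u. L2_on \<tau> u \<and>
        (\<exists>x. is_solution A B \<tau> u (\<psi> 0) x \<and> relaxation_norm \<tau> (\<lambda>t. x t - \<psi> t) \<le> \<epsilon>))"

end

theory Submission
  imports Defs
begin

text \<open>
  If \<open>B\<close> is onto, then every continuously differentiable path \<open>x\<close> is a trajectory: with a linear
  right inverse \<open>R\<close> of \<open>B\<close>, the control \<open>u = R (x' + A x)\<close> produces it. Given a target \<open>\<psi>\<close>,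
  it therefore suffices to find a smooth path that starts at \<open>\<psi> 0\<close> and is uniformly close to
  \<open>\<psi>\<close>, and the Weierstrass theorem, applied to each coordinate, supplies one
  (\<open>uniform_approximation_by_smooth_path\<close>).

  Conversely, let \<open>y\<close> be orthogonal to the range of \<open>B\<close>. Pairing the equation with \<open>y\<close> removes the
  control, and integrating in time gives \<open>y \<bullet> x t = y \<bullet> x 0 - y \<bullet> A (\<integral>\<^sub>0\<^sup>t x)\<close>. Here the right-hand
  side depends on \<open>x\<close> only through a time integral, which is known up to \<open>\<epsilon>\<close> in the relaxation
  norm. A second integration makes the left-hand side such an integral too. Letting \<open>\<epsilon>\<close> tend to
  zero, every target must itself satisfy the twice integrated identity. For the target
  \<open>\<psi> t = t y\<close> that identity reads
  \<open>s\<^sup>2 / 2 (y \<bullet> y) + s\<^sup>3 / 6 (y \<bullet> A y) = 0\<close> for all \<open>s\<close> in the interval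
  (\<open>tracking_defect_bound\<close>); the two monomials are independent, so \<open>y = 0\<close>. Since the
  range of \<open>B\<close> has finite dimension, a trivial orthogonal complement means that it is everything.
\<close>

section \<open>Finite-dimensional inner product spaces\<close>

text \<open>
  A finite spanning set does not make the type an instance of the class of Euclidean spaces, so
  coordinates are built by Gram-Schmidt. The orthogonal spanning set may contain 0;
  the corresponding summand then vanishes because division by zero yields zero.
\<close>

lemma orthogonal_projection_onto_finite_span:
  fixes S :: "'a::real_inner set"
  assumes "finite S"
  obtains C where "finite C" "span C = span S"
    "\<And>x s. s \<in> span S \<Longrightarrow> (x - (\<Sum>c\<in>C. ((x \<bullet> c) / (c \<bullet> c)) *\<^sub>R c)) \<bullet> s = 0"
proof -
  obtain C where C: "finite C" "span C = span S" "pairwise orthogonal C"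
    using basis_orthogonal[OF assms] by blast
  have orth: "(x - (\<Sum>c\<in>C. ((x \<bullet> c) / (c \<bullet> c)) *\<^sub>R c)) \<bullet> d = 0" if "d \<in> C" for x d
  proof -
    have "(\<Sum>c\<in>C. ((x \<bullet> c) / (c \<bullet> c)) *\<^sub>R c) \<bullet> d = (\<Sum>c\<in>C. if c = d then x \<bullet> d else 0)"
      unfolding inner_sum_left using C(3) that
      by (intro sum.cong refl) (auto simp: pairwise_def orthogonal_def)
    then show ?thesis
      using C(1) that by (simp add: inner_diff_left)
  qed
  have "(x - (\<Sum>c\<in>C. ((x \<bullet> c) / (c \<bullet> c)) *\<^sub>R c)) \<bullet> s = 0" if "s \<in> span S" for x s
    using that unfolding C(2)[symmetric]
  proof (induction rule: span_induct_alt)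
    case (step a d s)
    then show ?case using orth[of d x] by (simp add: inner_add_right)
  qed simp
  then show thesis by (rule that[OF C(1,2)])
qed

text \<open>
  The functionals \<open>x \<bullet> d c\<close> serve as coordinates: they reduce statements on vector-valued functions
  to real-valued ones.
\<close>

lemma finite_coordinate_system:
  fixes S :: "'a::real_inner set"
  assumes "finite S" "span S = UNIV"
  obtains C d where "finite C" "\<And>x::'a. (\<Sum>c\<in>C. (x \<bullet> d c) *\<^sub>R c) = x"
proof -
  obtain C where C: "finite C"
    "\<And>x s. s \<in> span S \<Longrightarrow> (x - (\<Sum>c\<in>C. ((x \<bullet> c) / (c \<bullet> c)) *\<^sub>R c)) \<bullet> s = 0"
    by (rule orthogonal_projection_onto_finite_span[OF assms(1)]) (rule that)
  have "(\<Sum>c\<in>C. (x \<bullet> (c /\<^sub>R (c \<bullet> c))) *\<^sub>R c) = x" for x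
    using C(2)[of "x - (\<Sum>c\<in>C. ((x \<bullet> c) / (c \<bullet> c)) *\<^sub>R c)" x] assms(2)
    by (simp add: divide_inverse mult.commute)
  with C(1) show thesis by (rule that)
qed

lemma linear_imp_bounded_linear_finite_span:
  fixes f :: "'a::real_inner \<Rightarrow> 'b::real_normed_vector"
  assumes S: "finite S" "span S = (UNIV::'a set)" and f: "linear f"
  shows "bounded_linear f"
proof -
  obtain C d where C: "finite C" "\<And>x::'a. (\<Sum>c\<in>C. (x \<bullet> d c) *\<^sub>R c) = x"
    by (rule finite_coordinate_system[OF S]) (rule that)
  have "f = (\<lambda>x. \<Sum>c\<in>C. (x \<bullet> d c) *\<^sub>R f c)"
  proof
    fix x
    have "f x = f (\<Sum>c\<in>C. (x \<bullet> d c) *\<^sub>R c)" by (simp only: C(2))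
    then show "f x = (\<Sum>c\<in>C. (x \<bullet> d c) *\<^sub>R f c)"
      by (simp add: linear_sum[OF f] linear_cmul[OF f])
  qed
  moreover have "bounded_linear (\<lambda>x. \<Sum>c\<in>C. (x \<bullet> d c) *\<^sub>R f c)"
    by (intro bounded_linear_sum bounded_linear_scaleR_const bounded_linear_inner_left)
  ultimately show ?thesis by simp
qed

section \<open>Lebesgue integrals over intervals\<close>

lemma continuous_imp_integrable_lebesgue_on_interval:
  fixes f :: "real \<Rightarrow> 'a::{banach, second_countable_topology}"
  assumes "continuous_on {a..b} f"
  shows "integrable (lebesgue_on {a..b}) f"
proof -
  obtain K where "\<And>t. t \<in> {a..b} \<Longrightarrow> norm (f t) \<le> K"
    using compact_imp_bounded[OF compact_continuous_image[OF assms compact_Icc]]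
    unfolding bounded_iff by blast
  moreover have "finite_measure (lebesgue_on {a..b})"
    by (rule finite_measure_lebesgue_on) simp
  moreover have "f \<in> borel_measurable (lebesgue_on {a..b})"
    by (rule continuous_imp_measurable_on_sets_lebesgue[OF assms]) simp
  ultimately show ?thesis
    by (intro finite_measure.integrable_const_bound[of _ _ K] AE_I2) auto
qed

lemma continuous_imp_L2_on:
  fixes f :: "real \<Rightarrow> 'a::{banach, second_countable_topology}"
  assumes "continuous_on {0..\<tau>} f"
  shows "L2_on \<tau> f"
  unfolding L2_on_def
  by (intro conjI continuous_imp_measurable_on_sets_lebesgue assms
      continuous_imp_integrable_lebesgue_on_interval continuous_intros) simp

lemma lebesgue_integral_derivative:
  fixes f g :: "real \<Rightarrow> real"
  assumes "a \<le> b" "\<And>t. (f has_real_derivative g t) (at t)" "continuous_on {a..b} g"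
  shows "integral\<^sup>L (lebesgue_on {a..b}) g = f b - f a"
proof -
  have "(g has_integral (f b - f a)) {a..b}"
    using assms by (intro fundamental_theorem_of_calculus)
      (auto simp: has_real_derivative_iff_has_vector_derivative
        intro: has_vector_derivative_at_within)
  then show ?thesis
    using lebesgue_integral_eq_integral[OF continuous_imp_integrable_lebesgue_on_interval[OF assms(3)]]
    by (simp add: integral_unique)
qed

lemma lebesgue_on_subinterval:
  assumes "(t::real) \<le> \<tau>"
  shows "lebesgue_on {0..t} = restrict_space (lebesgue_on {0..\<tau>}) {0..t}"
    and "{0..t} \<inter> space (lebesgue_on {0..\<tau>}) \<in> sets (lebesgue_on {0..\<tau>})"
  using assms by (auto simp: restrict_restrict_space inf_absorb2 sets_restrict_space)

lemma integrable_lebesgue_on_subinterval: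
  fixes v :: "real \<Rightarrow> 'a::{banach, second_countable_topology}"
  assumes "integrable (lebesgue_on {0..\<tau>}) v" "t \<le> \<tau>"
  shows "integrable (lebesgue_on {0..t}) v"
  unfolding lebesgue_on_subinterval(1)[OF assms(2)]
    integrable_restrict_space[OF lebesgue_on_subinterval(2)[OF assms(2)]]
  using assms
  by (intro integrable_mult_indicator) (auto simp: sets_restrict_space)

lemma AE_lebesgue_on_subinterval:
  assumes "AE s in lebesgue_on {0..\<tau>}. P s" "(t::real) \<le> \<tau>"
  shows "AE s in lebesgue_on {0..t}. P s"
  unfolding lebesgue_on_subinterval(1)[OF assms(2)]
    AE_restrict_space_iff[OF lebesgue_on_subinterval(2)[OF assms(2)]]
  using assms(1) by (auto elim: eventually_mono)

lemma norm_lebesgue_integral_interval_le: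
  fixes f :: "real \<Rightarrow> 'a::{banach, second_countable_topology}"
  assumes "\<And>s. s \<in> {0..t} \<Longrightarrow> norm (f s) \<le> K" "0 \<le> t"
    and "integrable (lebesgue_on {0..t}) f"
  shows "norm (integral\<^sup>L (lebesgue_on {0..t}) f) \<le> t * K"
proof -
  have "norm (integral\<^sup>L (lebesgue_on {0..t}) f) \<le> (\<integral>s. K \<partial>lebesgue_on {0..t})"
    using assms by (intro Bochner_Integration.integral_norm_bound_integral) auto
  then show ?thesis using assms by (simp add: measure_restrict_space)
qed

lemma continuous_on_indefinite_lebesgue_integral:
  fixes v :: "real \<Rightarrow> 'a::{real_inner, banach, second_countable_topology}"
  assumes S: "finite S" "span S = (UNIV::'a set)"
    and v: "integrable (lebesgue_on {0..\<tau>}) v"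
  shows "continuous_on {0..\<tau>} (\<lambda>t. integral\<^sup>L (lebesgue_on {0..t}) v)"
proof -
  obtain C d where C: "finite C" "\<And>x::'a. (\<Sum>c\<in>C. (x \<bullet> d c) *\<^sub>R c) = x"
    by (rule finite_coordinate_system[OF S]) (rule that)
  have "continuous_on {0..\<tau>} (\<lambda>t. \<Sum>c\<in>C. integral\<^sup>L (lebesgue_on {0..t}) (\<lambda>s. v s \<bullet> d c) *\<^sub>R c)"
    using v by (intro continuous_intros indefinite_integral_continuous_real integrable_inner_left)
  then show ?thesis
    by (rule continuous_on_eq)
      (simp add: C(2) integrable_lebesgue_on_subinterval[OF v])
qed

section \<open>The relaxation norm\<close>

text \<open>
  Continuity makes the integrals bounded in \<open>t\<close>; without a bound the supremum of reals that
  defines the relaxation norm would be an arbitrary number.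
\<close>

lemma norm_integral_le_relaxation_norm:
  fixes f :: "real \<Rightarrow> 'a::{banach, second_countable_topology}"
  assumes f: "continuous_on {0..\<tau>} f" and t: "t \<in> {0..\<tau>}"
  shows "norm (integral\<^sup>L (lebesgue_on {0..t}) f) \<le> relaxation_norm \<tau> f"
  unfolding relaxation_norm_def
proof (rule cSUP_upper[OF t])
  obtain K where K: "\<And>t. t \<in> {0..\<tau>} \<Longrightarrow> norm (f t) \<le> K"
    using compact_imp_bounded[OF compact_continuous_image[OF f compact_Icc]]
    unfolding bounded_iff by blast
  have "norm (integral\<^sup>L (lebesgue_on {0..s}) f) \<le> \<tau> * K" if s: "s \<in> {0..\<tau>}" for s
  proof -
    have "0 \<le> K" using K[OF s] norm_ge_zero order_trans by blast
    have "norm (integral\<^sup>L (lebesgue_on {0..s}) f) \<le> s * K"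
      using s K continuous_on_subset[OF f]
      by (intro norm_lebesgue_integral_interval_le continuous_imp_integrable_lebesgue_on_interval)
        auto
    also have "\<dots> \<le> \<tau> * K"
      using s \<open>0 \<le> K\<close> by (intro mult_right_mono) auto
    finally show ?thesis .
  qed
  then show "bdd_above ((\<lambda>s. norm (integral\<^sup>L (lebesgue_on {0..s}) f)) ` {0..\<tau>})"
    by (rule bdd_aboveI2)
qed

lemma relaxation_norm_le_uniform:
  fixes f :: "real \<Rightarrow> 'a::{banach, second_countable_topology}"
  assumes f: "continuous_on {0..\<tau>} f" and "0 \<le> \<tau>"
    and K: "\<And>t. t \<in> {0..\<tau>} \<Longrightarrow> norm (f t) \<le> K"
  shows "relaxation_norm \<tau> f \<le> \<tau> * K"
  unfolding relaxation_norm_def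
proof (rule cSUP_least)
  fix s assume s: "s \<in> {0..\<tau>}"
  have "0 \<le> K" using K[OF s] norm_ge_zero order_trans by blast
  have "norm (integral\<^sup>L (lebesgue_on {0..s}) f) \<le> s * K"
    using s K continuous_on_subset[OF f]
    by (intro norm_lebesgue_integral_interval_le continuous_imp_integrable_lebesgue_on_interval)
      auto
  also have "\<dots> \<le> \<tau> * K"
    using s \<open>0 \<le> K\<close> by (intro mult_right_mono) auto
  finally show "norm (integral\<^sup>L (lebesgue_on {0..s}) f) \<le> \<tau> * K" .
qed (use assms in auto)

section \<open>Linear paths as targets\<close>

lemma integral_lebesgue_on_open_interval:
  fixes f :: "real \<Rightarrow> 'a::{banach, second_countable_topology}"
  assumes "continuous_on {a..b} f"
  shows "integral\<^sup>L (lebesgue_on {a<..<b}) f = integral\<^sup>L (lebesgue_on {a..b}) f"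
proof -
  have meas: "(\<lambda>t. indicator I t *\<^sub>R f t) \<in> borel_measurable lebesgue"
    if "I \<subseteq> {a..b}" "I \<in> sets lebesgue" for I
  proof -
    have "f \<in> borel_measurable (lebesgue_on I)"
      using that by (intro continuous_imp_measurable_on_sets_lebesgue continuous_on_subset[OF assms])
    then show ?thesis using that by (simp add: borel_measurable_restrict_space_iff)
  qed
  have "AE t in lebesgue. t \<notin> {a, b}"
    by (rule AE_not_in) (simp add: finite_imp_null_set_lborel null_sets_completionI)
  then have "AE t in lebesgue. indicator {a<..<b} t *\<^sub>R f t = indicator {a..b} t *\<^sub>R f t"
    by (rule eventually_mono) (auto simp: indicator_def)
  then have "(\<integral>t. indicator {a<..<b} t *\<^sub>R f t \<partial>lebesgue) = (\<integral>t. indicator {a..b} t *\<^sub>R f t \<partial>lebesgue)"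
    by (intro integral_cong_AE meas) auto
  then show ?thesis by (simp add: integral_restrict_space)
qed

text \<open>
  The weak derivative is the constant \<open>y\<close>: integrate the derivative of \<open>t \<phi> t\<close>, whose boundary
  values vanish for a test function \<open>\<phi>\<close>.
\<close>

lemma linear_path_in_W12:
  fixes y :: "'a::{banach, second_countable_topology}"
  assumes "\<tau> > 0"
  shows "(\<lambda>t. t *\<^sub>R y) \<in> W12 \<tau>"
proof -
  have "weak_derivative \<tau> (\<lambda>t. t *\<^sub>R y) (\<lambda>t. y)"
    unfolding weak_derivative_def
  proof (intro allI impI)
    fix \<phi> :: "real \<Rightarrow> real" assume \<phi>: "test_function \<tau> \<phi>"
    then have diff: "((deriv ^^ k) \<phi>) differentiable (at t)" for k t
      by (auto simp: test_function_def)
    have d0: "(\<phi> has_real_derivative deriv \<phi> t) (at t)" for t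
      using diff[of 0 t] by (simp add: DERIV_deriv_iff_real_differentiable)
    have c0: "continuous_on {0..\<tau>} \<phi>"
      by (rule DERIV_continuous_on[OF has_field_derivative_at_within[OF d0]])
    have c1: "continuous_on {0..\<tau>} (deriv \<phi>)"
      using diff[of 1] by (auto intro!: continuous_at_imp_continuous_on differentiable_imp_continuous_within)
    have ends: "\<phi> 0 = 0" "\<phi> \<tau> = 0"
      using \<phi> unfolding test_function_def by (metis greaterThanLessThan_iff less_irrefl subset_iff)+
    have int: "integrable (lebesgue_on {0..\<tau>}) (\<lambda>t. deriv \<phi> t * t)" "integrable (lebesgue_on {0..\<tau>}) \<phi>"
      by (intro continuous_imp_integrable_lebesgue_on_interval continuous_intros c0 c1)+
    have "integral\<^sup>L (lebesgue_on {0..\<tau>}) (\<lambda>t. deriv \<phi> t * t + \<phi> t) = \<phi> \<tau> * \<tau> - \<phi> 0 * 0"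
      using assms by (intro lebesgue_integral_derivative)
        (auto intro!: derivative_eq_intros d0 continuous_intros c0 c1)
    then have "integral\<^sup>L (lebesgue_on {0..\<tau>}) (\<lambda>t. deriv \<phi> t * t)
        = - integral\<^sup>L (lebesgue_on {0..\<tau>}) \<phi>"
      using int ends by simp
    then have "integral\<^sup>L (lebesgue_on {0..\<tau>}) (\<lambda>t. deriv \<phi> t *\<^sub>R t *\<^sub>R y)
        = - integral\<^sup>L (lebesgue_on {0..\<tau>}) (\<lambda>t. \<phi> t *\<^sub>R y)"
      using int by simp
    moreover have "continuous_on {0..\<tau>} (\<lambda>t. deriv \<phi> t *\<^sub>R t *\<^sub>R y)"
      "continuous_on {0..\<tau>} (\<lambda>t. \<phi> t *\<^sub>R y)"
      by (intro continuous_intros c0 c1)+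
    ultimately show "integral\<^sup>L (lebesgue_on {0<..<\<tau>}) (\<lambda>t. deriv \<phi> t *\<^sub>R t *\<^sub>R y)
        = - integral\<^sup>L (lebesgue_on {0<..<\<tau>}) (\<lambda>t. \<phi> t *\<^sub>R y)"
      by (simp only: integral_lebesgue_on_open_interval)
  qed
  moreover have "continuous_on {0..\<tau>} (\<lambda>t. t *\<^sub>R y)" by (intro continuous_intros)
  ultimately show ?thesis
    unfolding W12_def using continuous_imp_L2_on[of \<tau> "\<lambda>t. t *\<^sub>R y"]
      continuous_imp_L2_on[of \<tau> "\<lambda>t. y"] by auto
qed

section \<open>Controllability when the control operator is onto\<close>

text \<open>
  Each coordinate of \<open>\<psi>\<close> is approximated by a polynomial \<open>p\<close>. Replacing \<open>p t\<close> by
  \<open>p t - p 0\<close> and adding \<open>\<psi> 0\<close> enforces the exact initial value, at the price of doubling the error.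
\<close>

lemma uniform_approximation_by_smooth_path:
  fixes \<psi> :: "real \<Rightarrow> 'a::{real_inner, banach, second_countable_topology}"
  assumes S: "finite S" "span S = (UNIV::'a set)"
    and \<psi>: "continuous_on {0..\<tau>} \<psi>" and "0 \<le> \<tau>" "0 < \<delta>"
  obtains x w where "continuous_on {0..\<tau>} x" "continuous_on {0..\<tau>} w"
    "\<And>t. t \<in> {0..\<tau>} \<Longrightarrow> x t = \<psi> 0 + integral\<^sup>L (lebesgue_on {0..t}) w"
    "\<And>t. t \<in> {0..\<tau>} \<Longrightarrow> norm (x t - \<psi> t) \<le> \<delta>"
proof -
  obtain C d where C: "finite C" "\<And>x::'a. (\<Sum>c\<in>C. (x \<bullet> d c) *\<^sub>R c) = x"
    by (rule finite_coordinate_system[OF S]) (rule that)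
  \<comment> \<open>Coordinate error: doubled and summed with the weights \<open>norm c\<close>, it stays below \<open>\<delta>\<close>; adding 1
    to the sum of the weights keeps the denominator positive when that sum is zero.\<close>
  define \<eta> where "\<eta> = \<delta> / (2 * (1 + (\<Sum>c\<in>C. norm c)))"
  have N: "0 \<le> (\<Sum>c\<in>C. norm c)" by (simp add: sum_nonneg)
  then have \<eta>: "\<eta> > 0" using \<open>0 < \<delta>\<close> by (simp add: \<eta>_def)
  have "\<exists>p p'. continuous_on UNIV p' \<and> (\<forall>t. (p has_real_derivative p' t) (at t)) \<and>
      (\<forall>t\<in>{0..\<tau>}. \<bar>\<psi> t \<bullet> d c - p t\<bar> < \<eta>)" for c
  proof -
    have "continuous_on {0..\<tau>} (\<lambda>t. \<psi> t \<bullet> d c)" by (intro continuous_intros \<psi>)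
    then obtain p where p: "polynomial_function p" "\<forall>t\<in>{0..\<tau>}. norm (\<psi> t \<bullet> d c - p t) < \<eta>"
      using Stone_Weierstrass_polynomial_function[OF compact_Icc _ \<eta>] by blast
    moreover obtain p' where "polynomial_function p'"
      "\<And>t. (p has_vector_derivative p' t) (at t)"
      using has_vector_derivative_polynomial_function[OF p(1)] by blast
    ultimately show ?thesis
      by (auto simp: has_real_derivative_iff_has_vector_derivative
          intro: continuous_on_polymonial_function)
  qed
  then obtain p p' where p': "\<And>c. continuous_on UNIV (p' c)"
    and der: "\<And>c t. (p c has_real_derivative p' c t) (at t)"
    and close: "\<And>c t. t \<in> {0..\<tau>} \<Longrightarrow> \<bar>\<psi> t \<bullet> d c - p c t\<bar> < \<eta>"
    by metis
  define x where "x t = \<psi> 0 + (\<Sum>c\<in>C. (p c t - p c 0) *\<^sub>R c)" for t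
  define w where "w t = (\<Sum>c\<in>C. p' c t *\<^sub>R c)" for t
  have cp: "continuous_on {0..\<tau>} (p c)" for c
    by (rule DERIV_continuous_on[OF has_field_derivative_at_within[OF der]])
  have cp': "continuous_on T (p' c)" for c T
    using p' continuous_on_subset by blast
  show thesis
  proof
    show "continuous_on {0..\<tau>} x" unfolding x_def by (intro continuous_intros cp)
    show "continuous_on {0..\<tau>} w" unfolding w_def by (intro continuous_intros cp')
  next
    fix t assume t: "t \<in> {0..\<tau>}"
    have "integral\<^sup>L (lebesgue_on {0..t}) w = (\<Sum>c\<in>C. integral\<^sup>L (lebesgue_on {0..t}) (p' c) *\<^sub>R c)"
      unfolding w_def using continuous_imp_integrable_lebesgue_on_interval[OF cp']
      by (subst Bochner_Integration.integral_sum) auto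
    also have "\<dots> = (\<Sum>c\<in>C. (p c t - p c 0) *\<^sub>R c)"
      using t by (simp add: lebesgue_integral_derivative[OF _ der cp'])
    finally show "x t = \<psi> 0 + integral\<^sup>L (lebesgue_on {0..t}) w" by (simp add: x_def)
    have "x t - \<psi> t = \<psi> 0 - \<psi> t + (\<Sum>c\<in>C. (p c t - p c 0) *\<^sub>R c)" by (simp add: x_def)
    also have "\<psi> 0 - \<psi> t = (\<Sum>c\<in>C. ((\<psi> 0 - \<psi> t) \<bullet> d c) *\<^sub>R c)" by (simp only: C(2))
    finally have "x t - \<psi> t = (\<Sum>c\<in>C. ((\<psi> 0 \<bullet> d c - p c 0) - (\<psi> t \<bullet> d c - p c t)) *\<^sub>R c)"
      unfolding sum.distrib[symmetric] scaleR_left_distrib[symmetric]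
      by (simp add: inner_diff_left diff_add_eq add_diff_eq diff_diff_eq2 add.commute)
    also have "norm \<dots> \<le> (\<Sum>c\<in>C. 2 * \<eta> * norm c)"
    proof (intro order_trans[OF norm_sum] sum_mono)
      fix c
      have "\<bar>(\<psi> 0 \<bullet> d c - p c 0) - (\<psi> t \<bullet> d c - p c t)\<bar> \<le> 2 * \<eta>"
        using close[of 0 c] close[OF t, of c] \<open>0 \<le> \<tau>\<close> by auto
      then show "norm (((\<psi> 0 \<bullet> d c - p c 0) - (\<psi> t \<bullet> d c - p c t)) *\<^sub>R c) \<le> 2 * \<eta> * norm c"
        by (simp add: mult_right_mono)
    qed
    also have "\<dots> \<le> \<delta>"
      unfolding sum_distrib_left[symmetric] \<eta>_def
      using N \<open>0 < \<delta>\<close> by (simp add: field_simps)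
    finally show "norm (x t - \<psi> t) \<le> \<delta>" .
  qed
qed

lemma surj_imp_weakly_approx_tracking_controllable:
  fixes A :: "'x::{real_inner, banach, second_countable_topology} \<Rightarrow> 'x"
    and B :: "'u::{real_inner, banach, second_countable_topology} \<Rightarrow> 'x"
  assumes S: "finite S" "span S = (UNIV::'x set)"
    and A: "linear A" and B: "linear B" "surj B" and \<tau>: "\<tau> > 0"
  shows "weakly_approx_tracking_controllable A B \<tau>"
  unfolding weakly_approx_tracking_controllable_def
proof (intro ballI allI impI)
  fix \<psi> :: "real \<Rightarrow> 'x" and \<epsilon> :: real
  assume "\<psi> \<in> W12 \<tau>" and \<epsilon>: "\<epsilon> > 0"
  then have \<psi>: "continuous_on {0..\<tau>} \<psi>" by (simp add: W12_def)
  have "0 \<le> \<tau>" "0 < \<epsilon> / \<tau>" using \<epsilon> \<tau> by auto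
  then obtain x w where x: "continuous_on {0..\<tau>} x" and w: "continuous_on {0..\<tau>} w"
    and xw: "\<And>t. t \<in> {0..\<tau>} \<Longrightarrow> x t = \<psi> 0 + integral\<^sup>L (lebesgue_on {0..t}) w"
    and close: "\<And>t. t \<in> {0..\<tau>} \<Longrightarrow> norm (x t - \<psi> t) \<le> \<epsilon> / \<tau>"
    by (rule uniform_approximation_by_smooth_path[OF S \<psi>]) (rule that)
  obtain R where R: "linear R" "\<And>z. B (R z) = z"
    using linear_surjective_right_inverse[OF B] by (auto simp: fun_eq_iff)
  define u where "u t = R (w t + A (x t))" for t
  have "continuous_on {0..\<tau>} u"
    unfolding u_def
    by (intro bounded_linear.continuous_on[OF linear_imp_bounded_linear_finite_span[OF S R(1)]]
        bounded_linear.continuous_on[OF linear_imp_bounded_linear_finite_span[OF S A]]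
        continuous_on_add x w)
  moreover have "is_solution A B \<tau> u (\<psi> 0) x"
    unfolding is_solution_def using xw w
    by (intro exI[of _ w]) (auto simp: u_def R intro: continuous_imp_integrable_lebesgue_on_interval)
  moreover have "relaxation_norm \<tau> (\<lambda>t. x t - \<psi> t) \<le> \<tau> * (\<epsilon> / \<tau>)"
    using \<tau> close by (intro relaxation_norm_le_uniform continuous_intros x \<psi>) auto
  ultimately show "\<exists>u. L2_on \<tau> u \<and>
      (\<exists>x. is_solution A B \<tau> u (\<psi> 0) x \<and> relaxation_norm \<tau> (\<lambda>t. x t - \<psi> t) \<le> \<epsilon>)"
    using \<tau> by (auto intro: continuous_imp_L2_on)
qed

section \<open>Necessity of surjectivity\<close>

text \<open>
  The quantitative form of the twice integrated identity for the target \<open>t y\<close> with \<open>y\<close> orthogonal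
  to the range of \<open>B\<close>. Writing \<open>r t\<close> for the time integral of the error, one has
  \<open>\<integral>\<^sub>0\<^sup>t x = t\<^sup>2 / 2 y + r t\<close> with \<open>norm (r t) \<le> \<epsilon>\<close>. Inserting this into the once integrated
  equation gives \<open>y \<bullet> x t = - t\<^sup>2 / 2 (y \<bullet> A y) - y \<bullet> A (r t)\<close>, and integrating over \<open>t\<close> from 0 to \<open>s\<close>
  expresses the left-hand side as \<open>s\<^sup>2 / 2 (y \<bullet> y) + y \<bullet> r s\<close>. The terms with \<open>r\<close> make up the bound.
\<close>

lemma tracking_defect_bound:
  fixes A :: "'x::{real_inner, banach, second_countable_topology} \<Rightarrow> 'x"
    and B :: "'u::{real_inner, banach, second_countable_topology} \<Rightarrow> 'x"
  assumes S: "finite S" "span S = (UNIV::'x set)"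
    and A: "\<And>z. norm (A z) \<le> norm z * K" "bounded_linear A" "0 \<le> K"
    and y: "\<And>z. y \<bullet> B z = 0"
    and sol: "is_solution A B \<tau> u 0 x"
    and close: "relaxation_norm \<tau> (\<lambda>t. x t - t *\<^sub>R y) \<le> \<epsilon>"
    and s: "s \<in> {0..\<tau>}"
  shows "\<bar>s\<^sup>2 / 2 * (y \<bullet> y) + s ^ 3 / 6 * (y \<bullet> A y)\<bar> \<le> norm y * (1 + \<tau> * K) * \<epsilon>"
proof -
  obtain v where v: "integrable (lebesgue_on {0..\<tau>}) v"
    and xv: "\<And>t. t \<in> {0..\<tau>} \<Longrightarrow> x t = integral\<^sup>L (lebesgue_on {0..t}) v"
    and eq: "AE t in lebesgue_on {0..\<tau>}. v t + A (x t) = B (u t)"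
    using sol unfolding is_solution_def by auto
  have x: "continuous_on {0..\<tau>} x"
    by (rule continuous_on_eq[OF continuous_on_indefinite_lebesgue_integral[OF S v]]) (simp add: xv)
  have int_x: "integrable (lebesgue_on {0..t}) x" if "t \<in> {0..\<tau>}" for t
    using that by (intro continuous_imp_integrable_lebesgue_on_interval continuous_on_subset[OF x]) auto
  define r where "r t = integral\<^sup>L (lebesgue_on {0..t}) (\<lambda>s. x s - s *\<^sub>R y)" for t
  have r: "norm (r t) \<le> \<epsilon>" if "t \<in> {0..\<tau>}" for t
    unfolding r_def using that
    by (intro order_trans[OF norm_integral_le_relaxation_norm close] continuous_intros x)
  have X: "integral\<^sup>L (lebesgue_on {0..t}) x = (t\<^sup>2 / 2) *\<^sub>R y + r t" if t: "t \<in> {0..\<tau>}" for t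
  proof -
    have "integrable (lebesgue_on {0..t}) (\<lambda>s. s)"
      by (intro continuous_imp_integrable_lebesgue_on_interval continuous_intros)
    moreover have "integral\<^sup>L (lebesgue_on {0..t}) (\<lambda>s. s) = t\<^sup>2 / 2 - 0\<^sup>2 / 2"
      using t by (intro lebesgue_integral_derivative) (auto intro!: derivative_eq_intros continuous_intros)
    ultimately show ?thesis using int_x[OF t] by (simp add: r_def)
  qed
  have yx: "y \<bullet> x t = - (t\<^sup>2 / 2 * (y \<bullet> A y)) - y \<bullet> A (r t)" if t: "t \<in> {0..\<tau>}" for t
  proof -
    have vt: "integrable (lebesgue_on {0..t}) v"
      using t by (intro integrable_lebesgue_on_subinterval[OF v]) auto
    have Ax: "integrable (lebesgue_on {0..t}) (\<lambda>s. A (x s))"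
      by (rule integrable_bounded_linear[OF A(2) int_x[OF t]])
    have "AE s in lebesgue_on {0..t}. v s + A (x s) = B (u s)"
      using t by (intro AE_lebesgue_on_subinterval[OF eq]) auto
    then have "AE s in lebesgue_on {0..t}. y \<bullet> (v s + A (x s)) = 0"
      by (auto simp: y elim: eventually_mono)
    then have "integral\<^sup>L (lebesgue_on {0..t}) (\<lambda>s. y \<bullet> (v s + A (x s))) = 0"
      by (rule integral_eq_zero_AE)
    then have "y \<bullet> (integral\<^sup>L (lebesgue_on {0..t}) v + A (integral\<^sup>L (lebesgue_on {0..t}) x)) = 0"
      using vt Ax integral_bounded_linear[OF A(2) int_x[OF t]] by simp
    then show ?thesis
      using t by (simp add: xv[OF t, symmetric] X linear_add linear_cmul
          bounded_linear.linear[OF A(2)] inner_add_right)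
  qed
  have "y \<bullet> x t + t\<^sup>2 / 2 * (y \<bullet> A y) = - (y \<bullet> A (r t))" if "t \<in> {0..\<tau>}" for t
    using yx[OF that] by simp
  moreover have yAr: "\<bar>y \<bullet> A (r t)\<bar> \<le> norm y * K * \<epsilon>" if "t \<in> {0..\<tau>}" for t
  proof -
    have "\<bar>y \<bullet> A (r t)\<bar> \<le> norm y * norm (A (r t))" by (rule Cauchy_Schwarz_ineq2)
    also have "\<dots> \<le> norm y * (\<epsilon> * K)"
      using A(1)[of "r t"] mult_right_mono[OF r[OF that] A(3)] by (intro mult_left_mono) auto
    finally show ?thesis by (simp add: ac_simps)
  qed
  ultimately have bound: "\<bar>y \<bullet> x t + t\<^sup>2 / 2 * (y \<bullet> A y)\<bar> \<le> norm y * K * \<epsilon>" if "t \<in> {0..\<tau>}" for t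
    using that by simp
  have sq: "integrable (lebesgue_on {0..s}) (\<lambda>t. t\<^sup>2 / 2 * (y \<bullet> A y))"
    by (intro continuous_imp_integrable_lebesgue_on_interval continuous_intros) simp
  have "integral\<^sup>L (lebesgue_on {0..s}) (\<lambda>t. t\<^sup>2 / 2 * (y \<bullet> A y))
      = s ^ 3 / 6 * (y \<bullet> A y) - 0 ^ 3 / 6 * (y \<bullet> A y)"
    using s by (intro lebesgue_integral_derivative)
      (auto intro!: derivative_eq_intros continuous_intros simp: field_simps)
  then have "integral\<^sup>L (lebesgue_on {0..s}) (\<lambda>t. y \<bullet> x t + t\<^sup>2 / 2 * (y \<bullet> A y))
      = y \<bullet> integral\<^sup>L (lebesgue_on {0..s}) x + s ^ 3 / 6 * (y \<bullet> A y)"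
    using sq int_x[OF s] by simp
  moreover have "norm (integral\<^sup>L (lebesgue_on {0..s}) (\<lambda>t. y \<bullet> x t + t\<^sup>2 / 2 * (y \<bullet> A y)))
      \<le> s * (norm y * K * \<epsilon>)"
    using s bound sq int_x[OF s] by (intro norm_lebesgue_integral_interval_le) auto
  ultimately have "\<bar>s\<^sup>2 / 2 * (y \<bullet> y) + s ^ 3 / 6 * (y \<bullet> A y) + y \<bullet> r s\<bar> \<le> s * (norm y * K * \<epsilon>)"
    by (simp add: X[OF s] inner_add_right algebra_simps)
  moreover have "s * (norm y * K * \<epsilon>) \<le> \<tau> * (norm y * K * \<epsilon>)"
    using s yAr[OF s] by (intro mult_right_mono) auto
  moreover have "\<bar>y \<bullet> r s\<bar> \<le> norm y * \<epsilon>"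
    by (rule order_trans[OF Cauchy_Schwarz_ineq2]) (simp add: mult_left_mono r[OF s])
  ultimately show ?thesis by (simp add: algebra_simps)
qed

lemma weakly_approx_tracking_controllable_imp_surj:
  fixes A :: "'x::{real_inner, banach, second_countable_topology} \<Rightarrow> 'x"
    and B :: "'u::{real_inner, banach, second_countable_topology} \<Rightarrow> 'x"
  assumes S: "finite S" "span S = (UNIV::'x set)"
    and T: "finite T" "span T = (UNIV::'u set)"
    and A: "linear A" and B: "linear B" and \<tau>: "\<tau> > 0"
    and ctrl: "weakly_approx_tracking_controllable A B \<tau>"
  shows "surj B"
proof -
  have range_B: "span (B ` T) = range B"
    by (simp add: linear_span_image[OF B] T)
  obtain C where C: "finite C" "span C = range B"
    "\<And>x s. s \<in> range B \<Longrightarrow> (x - (\<Sum>c\<in>C. ((x \<bullet> c) / (c \<bullet> c)) *\<^sub>R c)) \<bullet> s = 0"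
    by (rule orthogonal_projection_onto_finite_span[OF finite_imageI[OF T(1)], of B, unfolded range_B])
      (rule that)
  have bA: "bounded_linear A" by (rule linear_imp_bounded_linear_finite_span[OF S A])
  obtain K where K: "0 \<le> K" "\<And>z. norm (A z) \<le> norm z * K"
    using bounded_linear.nonneg_bounded[OF bA] by blast
  \<comment> \<open>Taking \<open>y\<close> to be \<open>z\<close> minus its projection then puts every \<open>z\<close> into the range.\<close>
  have orth_zero: "y = 0" if y: "\<And>z. y \<bullet> B z = 0" for y
  proof -
    have defect: "s\<^sup>2 / 2 * (y \<bullet> y) + s ^ 3 / 6 * (y \<bullet> A y) = 0" if s: "s \<in> {0..\<tau>}" for s
    proof -
      have "\<bar>s\<^sup>2 / 2 * (y \<bullet> y) + s ^ 3 / 6 * (y \<bullet> A y)\<bar> \<le> 0 + e" if "e > 0" for e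
      proof -
        \<comment> \<open>Tracking up to \<open>e / (M + 1)\<close> rather than \<open>e / M\<close>, since \<open>M\<close> may be zero.\<close>
        define M where "M = norm y * (1 + \<tau> * K)"
        have M: "0 \<le> M" using K \<tau> by (simp add: M_def)
        have "0 < e / (M + 1)" using \<open>e > 0\<close> M by simp
        then obtain u x where "is_solution A B \<tau> u (0 *\<^sub>R y) x"
          and close: "relaxation_norm \<tau> (\<lambda>t. x t - t *\<^sub>R y) \<le> e / (M + 1)"
          using ctrl linear_path_in_W12[OF \<tau>, of y]
          unfolding weakly_approx_tracking_controllable_def by meson
        then have sol: "is_solution A B \<tau> u 0 x" by simp
        have "\<bar>s\<^sup>2 / 2 * (y \<bullet> y) + s ^ 3 / 6 * (y \<bullet> A y)\<bar> \<le> M * (e / (M + 1))"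
          using tracking_defect_bound[OF S K(2) bA K(1) y sol close s] by (simp only: M_def)
        also have "\<dots> \<le> e" using M \<open>e > 0\<close> by (simp add: field_simps)
        finally show ?thesis by simp
      qed
      then have "\<bar>s\<^sup>2 / 2 * (y \<bullet> y) + s ^ 3 / 6 * (y \<bullet> A y)\<bar> \<le> 0"
        by (rule field_le_epsilon)
      then show ?thesis by simp
    qed
    \<comment> \<open>Two values of \<open>s\<close> separate the quadratic from the cubic term.\<close>
    have "\<tau>\<^sup>2 * (y \<bullet> y) / 2 + \<tau> ^ 3 * (y \<bullet> A y) / 6 = 0"
      "\<tau>\<^sup>2 * (y \<bullet> y) / 8 + \<tau> ^ 3 * (y \<bullet> A y) / 48 = 0"
      using defect[of \<tau>] defect[of "\<tau> / 2"] \<tau> by (simp_all add: power_divide)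
    then have "\<tau>\<^sup>2 * (y \<bullet> y) = 0" by linarith
    then show ?thesis using \<tau> by simp
  qed
  have "z \<in> range B" for z
  proof -
    have "z - (\<Sum>c\<in>C. ((z \<bullet> c) / (c \<bullet> c)) *\<^sub>R c) = 0"
      by (intro orth_zero C(3) rangeI)
    then have "z = (\<Sum>c\<in>C. ((z \<bullet> c) / (c \<bullet> c)) *\<^sub>R c)" by simp
    also have "\<dots> \<in> span C" by (intro span_sum span_scale span_base)
    finally show ?thesis by (simp add: C(2))
  qed
  then show ?thesis by auto
qed

theorem proposition1p5:
  fixes A :: "'x::{real_inner, banach, second_countable_topology} \<Rightarrow> 'x"
    and B :: "'u::{real_inner, banach, second_countable_topology} \<Rightarrow> 'x"
    and \<tau> :: real
  assumes "\<exists>S::'x set. finite S \<and> span S = UNIV"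
    and "\<exists>S::'u set. finite S \<and> span S = UNIV"
    and "linear A" and "linear B"
    and "\<tau> > 0"
  shows "weakly_approx_tracking_controllable A B \<tau> \<longleftrightarrow> surj B"
proof -
  obtain S :: "'x set" and T :: "'u set" where "finite S" "span S = UNIV" "finite T" "span T = UNIV"
    using assms(1,2) by blast
  then show ?thesis
    using weakly_approx_tracking_controllable_imp_surj[OF _ _ _ _ assms(3-5), of S T]
      surj_imp_weakly_approx_tracking_controllable[OF _ _ assms(3,4) _ assms(5), of S]
    by blast
qed

end
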